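(* Up to equivalence, the color adjacency matrices of the perfect 2-colorings of the Platonic graphs are exactly the following. Tetrahedral graph: $\begin{pmatrix}0&3\\1&2\end{pmatrix}$, $\begin{pmatrix}1&2\\2&1\end{pmatrix}$. Cube graph: $\begin{pmatrix}0&3\\1&2\end{pmatrix}$, $\begin{pmatrix}0&3\\3&0\end{pmatrix}$, $\begin{pmatrix}1&2\\2&1\end{pmatrix}$, $\begin{pmatrix}2&1\\1&2\end{pmatrix}$. Octahedral graph: $\begin{pmatrix}0&4\\2&2\end{pmatrix}$, $\begin{pmatrix}2&2\\2&2\end{pmatrix}$. Dodecahedral graph: $\begin{pmatrix}0&3\\2&1\end{pmatrix}$, $\begin{pmatrix}2&1\\1&2\end{pmatrix}$. Icosahedral graph: $\begin{pmatrix}0&5\\1&4\end{pmatrix}$, $\begin{pmatrix}1&4\\2&3\end{pmatrix}$, $\begin{pmatrix}2&3\\3&2\end{pmatrix}$. That is, for each of these graphs $G$, a $2\times 2$ matrix is the color adjacency matrix of some perfect 2-coloring of $G$ if and only if it is equivalent to one of the matrices listed for $G$.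
   Context: The Platonic graphs are the edge graphs (vertices and edges) of the five Platonic solids. An $m$-coloring of a graph $G=(V,E)$ is a partition of $V$ into $m$ disjoint nonempty sets $V_1,\ldots,V_m$ (the color classes; adjacent vertices may have the same color). The coloring is perfect if for all $i,j$ the number of neighbors of color $j$ of any vertex of color $i$ is a constant $a_{ij}$; the matrix $A=(a_{ij})_{1\le i,j\le m}$ is then called the color adjacency matrix of the perfect coloring. Two $m\times m$ matrices $A,B$ are equivalent (differ by a permutation of colors) if $B=PAP^{-1}$ for some permutation matrix $P$. *)

theory Defs
  imports "HOL-Analysis.Analysis"
begin

record 'a sgraph =
  verts :: "'a set"
  edges :: "'a set set"

definition edge_graph :: "'a::euclidean_space set \<Rightarrow> 'a sgraph" where
  "edge_graph P =
    \<lparr>verts = {v. v extreme_point_of P},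
     edges = {{u, v} | u v. closed_segment u v edge_of P}\<rparr>"

text \<open>Every Platonic solid is similar to exactly one of the following five. The coordinates are
  the standard ones; all five solids are centred at the origin.\<close>

definition tetrahedron :: "(real^3) set" where
  "tetrahedron = convex hull
    {vector [1, 1, 1], vector [1, -1, -1], vector [-1, 1, -1], vector [-1, -1, 1]}"

definition cube :: "(real^3) set" where
  "cube = convex hull {vector [x, y, z] | x y z. x \<in> {1, -1} \<and> y \<in> {1, -1} \<and> z \<in> {1, -1}}"

definition octahedron :: "(real^3) set" where
  "octahedron = convex hull
    {vector [1, 0, 0], vector [-1, 0, 0], vector [0, 1, 0], vector [0, -1, 0],
     vector [0, 0, 1], vector [0, 0, -1]}"

definition golden_ratio :: real where
  "golden_ratio = (1 + sqrt 5) / 2"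

definition dodecahedron :: "(real^3) set" where
  "dodecahedron = convex hull
    ({vector [x, y, z] | x y z. x \<in> {1, -1} \<and> y \<in> {1, -1} \<and> z \<in> {1, -1}} \<union>
     {vector [0, s / golden_ratio, t * golden_ratio] | s t. s \<in> {1, -1} \<and> t \<in> {1, -1}} \<union>
     {vector [s / golden_ratio, t * golden_ratio, 0] | s t. s \<in> {1, -1} \<and> t \<in> {1, -1}} \<union>
     {vector [t * golden_ratio, 0, s / golden_ratio] | s t. s \<in> {1, -1} \<and> t \<in> {1, -1}})"

definition icosahedron :: "(real^3) set" where
  "icosahedron = convex hull
    ({vector [0, s, t * golden_ratio] | s t. s \<in> {1, -1} \<and> t \<in> {1, -1}} \<union>
     {vector [s, t * golden_ratio, 0] | s t. s \<in> {1, -1} \<and> t \<in> {1, -1}} \<union>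
     {vector [t * golden_ratio, 0, s] | s t. s \<in> {1, -1} \<and> t \<in> {1, -1}})"

text \<open>A colouring is given by its family of colour classes, indexed by a finite type of colours.
  For \<open>m\<close> colours take an index type with \<open>m\<close> elements, such as \<open>2\<close>.\<close>

definition coloring :: "'a sgraph \<Rightarrow> ('m::finite \<Rightarrow> 'a set) \<Rightarrow> bool" where
  "coloring G W \<longleftrightarrow> (\<Union>i. W i) = verts G \<and> disjoint_family W \<and> (\<forall>i. W i \<noteq> {})"

definition neighbors_in :: "'a sgraph \<Rightarrow> 'a set \<Rightarrow> 'a \<Rightarrow> 'a set" where
  "neighbors_in G S v = {w \<in> S. {v, w} \<in> edges G}"

definition perfect_coloring :: "'a sgraph \<Rightarrow> ('m::finite \<Rightarrow> 'a set) \<Rightarrow> bool" where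
  "perfect_coloring G W \<longleftrightarrow>
    coloring G W \<and> (\<forall>i j. \<exists>a. \<forall>v \<in> W i. card (neighbors_in G (W j) v) = a)"

definition color_adjacency_matrix_of ::
    "'a sgraph \<Rightarrow> ('m::finite \<Rightarrow> 'a set) \<Rightarrow> real^'m^'m \<Rightarrow> bool" where
  "color_adjacency_matrix_of G W A \<longleftrightarrow>
    (\<forall>i j. \<forall>v \<in> W i. A $ i $ j = real (card (neighbors_in G (W j) v)))"

definition permutation_matrix :: "real^'m^'m \<Rightarrow> bool" where
  "permutation_matrix P \<longleftrightarrow>
    (\<exists>p. p permutes (UNIV :: 'm set) \<and> P = (\<chi> i j. if j = p i then 1 else 0))"

definition equivalent_matrices :: "real^'m^'m \<Rightarrow> real^'m^'m \<Rightarrow> bool" where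
  "equivalent_matrices A B \<longleftrightarrow>
    (\<exists>P. permutation_matrix P \<and> B = P ** A ** matrix_inv P)"

definition perfect_2_coloring_matrix :: "'a sgraph \<Rightarrow> real^2^2 \<Rightarrow> bool" where
  "perfect_2_coloring_matrix G A \<longleftrightarrow>
    (\<exists>W :: 2 \<Rightarrow> 'a set. perfect_coloring G W \<and> color_adjacency_matrix_of G W A)"

definition mat2 :: "real \<Rightarrow> real \<Rightarrow> real \<Rightarrow> real \<Rightarrow> real^2^2" where
  "mat2 a b c d = vector [vector [a, b], vector [c, d]]"

end

theory Submission
  imports Defs
begin

text \<open>The proof has a geometric half, which turns each solid into a concrete finite graph, and a
combinatorial half, which finds the perfect 2-colourings of that graph.

\<^bold>\<open>Geometry.\<close> All vertices lie on a sphere about the origin, so they are exactly the extreme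
points. Let \<open>m\<close> be the largest inner product of two distinct vertices. If \<open>u \<bullet> v = m\<close>, the functional
\<open>u + v\<close> attains its maximum over the solid exactly on the segment from \<open>u\<close> to \<open>v\<close>, which is
therefore an edge. Conversely, every vertex \<open>v\<close> lies in the cone at \<open>u\<close> spanned by the vertices \<open>w\<close>
with \<open>u \<bullet> w = m\<close>; a functional that is maximal at \<open>u\<close> and \<open>v\<close> is then maximal at one of these \<open>w\<close>
too, so no other segment is an edge (\<open>closed_segment_edge_of_hull_iff\<close>). The cone coefficients come
from one formula for all solids and are verified by exact computation in the ring of integers
extended by the golden ratio (\<open>represents_edge_graph\<close>).

\<^bold>\<open>Combinatorics.\<close> Let \<open>b\<close> and \<open>c\<close> be the numbers of neighbours of the other colour, in a graph of
degree \<open>k\<close>. The function with value \<open>b\<close> on the first colour and \<open>- c\<close> on the second is an eigenvector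
of the adjacency matrix with the integer eigenvalue \<open>k - b - c\<close>. It is orthogonal to the constants,
so \<open>k - b - c\<close> is a root of any polynomial \<open>q\<close> for which \<open>q\<close> of the adjacency matrix is a constant
matrix (Hoffman polynomial). This restricts \<open>b + c\<close> severely. Counting the edges between the colours
in two ways, \<open>n\<^sub>1 * b = n\<^sub>2 * c\<close>, removes all remaining cases that are not realized
(\<open>perfect_split_constraints\<close>), except \<open>b = c = 3\<close> for the octahedron, which parity excludes.
Explicit colourings realize the survivors. Finally, equivalence of 2 by 2 matrices is just the
exchange of the two colours (\<open>equivalent_mat2_iff\<close>).\<close>

section \<open>Edges of inscribed polytopes\<close>

text \<open>Balls are strictly convex: a point of the bounding sphere is never strictly between two points of
the ball.\<close>

lemma extreme_points_of_hull_in_sphere: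
  fixes S :: "'a::euclidean_space set"
  assumes "\<And>v. v \<in> S \<Longrightarrow> v \<bullet> v = r"
  shows "{v. v extreme_point_of convex hull S} = S"
proof
  show "{v. v extreme_point_of convex hull S} \<subseteq> S"
    by (rule extreme_points_of_convex_hull)
next
  show "S \<subseteq> {v. v extreme_point_of convex hull S}"
  proof
    fix v assume v: "v \<in> S"
    have nrm: "norm w = sqrt r" if "w \<in> S" for w
      using assms[OF that] by (simp add: norm_eq_sqrt_inner)
    have "S \<subseteq> cball 0 (sqrt r)" using nrm by auto
    then have hull: "convex hull S \<subseteq> cball 0 (sqrt r)"
      by (simp add: hull_minimal)
    have "v \<notin> open_segment a b" if "a \<in> convex hull S" "b \<in> convex hull S" for a b
    proof
      assume seg: "v \<in> open_segment a b"
      have "dist 0 v < dist 0 a \<or> dist 0 v < dist 0 b"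
        using dist_decreases_open_segment[OF seg, of 0] by blast
      then show False using that hull nrm[OF v] by (auto simp: subset_iff)
    qed
    then show "v \<in> {v. v extreme_point_of convex hull S}"
      using v by (auto simp: extreme_point_of_def hull_inc)
  qed
qed

text \<open>The hypothesis \<open>cone\<close> makes local optimality global: a functional that does not increase along the
segments from \<open>u\<close> to its neighbours does not increase towards any other vertex either.\<close>

lemma closed_segment_edge_of_hull_iff:
  fixes S :: "'a::euclidean_space set"
  assumes fin: "finite S" and sphere: "\<And>v. v \<in> S \<Longrightarrow> v \<bullet> v = r" and "m < r"
    and far: "\<And>u v. u \<in> S \<Longrightarrow> v \<in> S \<Longrightarrow> u \<noteq> v \<Longrightarrow> u \<bullet> v \<le> m"
    and cone: "\<And>u v. u \<in> S \<Longrightarrow> v \<in> S \<Longrightarrow> u \<noteq> v \<Longrightarrow> u \<bullet> v \<noteq> m \<Longrightarrow>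
      \<exists>N c. finite N \<and> N \<subseteq> {w \<in> S. u \<bullet> w = m} \<and> (\<forall>w\<in>N. 0 \<le> c w) \<and>
        v - u = (\<Sum>w\<in>N. c w *\<^sub>R (w - u))"
  shows "closed_segment u v edge_of convex hull S \<longleftrightarrow> u \<in> S \<and> v \<in> S \<and> u \<bullet> v = m"
proof -
  have ext: "{v. v extreme_point_of convex hull S} = S"
    using sphere by (rule extreme_points_of_hull_in_sphere)
  show ?thesis
  proof
    assume "closed_segment u v edge_of convex hull S"
    then have face: "closed_segment u v face_of convex hull S"
      and dim: "aff_dim (closed_segment u v) = 1"
      by (auto simp: edge_of_def)
    have uv: "u \<noteq> v"
      using dim by (auto simp: segment_convex_hull)
    have "u extreme_point_of convex hull S" "v extreme_point_of convex hull S"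
      using extreme_point_of_face[OF face, of u] extreme_point_of_face[OF face, of v]
      by (simp_all add: extreme_point_of_segment)
    then have S: "u \<in> S" "v \<in> S" using ext by blast+
    have "u \<bullet> v = m"
    proof (rule ccontr)
      assume "u \<bullet> v \<noteq> m"
      then obtain N c where N: "finite N" "N \<subseteq> {w \<in> S. u \<bullet> w = m}" "\<forall>w\<in>N. 0 \<le> c w"
        and sum: "v - u = (\<Sum>w\<in>N. c w *\<^sub>R (w - u))"
        using cone[OF S uv] by blast
      have "polyhedron (convex hull S)"
        by (simp add: fin finite_imp_compact polytope_convex_hull polytope_imp_polyhedron)
      then have "closed_segment u v exposed_face_of convex hull S"
        using face by (simp add: exposed_face_of_polyhedron)
      then obtain a b where ab: "convex hull S \<subseteq> {x. a \<bullet> x \<le> b}"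
          "closed_segment u v = convex hull S \<inter> {x. a \<bullet> x = b}"
        unfolding exposed_face_of_def by blast
      have au: "a \<bullet> u = b" and av: "a \<bullet> v = b" using ab(2) by auto
      have aw: "a \<bullet> w < b" if "w \<in> N" for w
      proof -
        have w: "w \<in> S" "u \<bullet> w = m" using that N by auto
        have "w \<noteq> u" "w \<noteq> v" using w \<open>u \<bullet> v \<noteq> m\<close> sphere[OF S(1)] \<open>m < r\<close> by auto
        moreover have "w extreme_point_of convex hull S" using w ext by auto
        ultimately have "w \<notin> closed_segment u v"
          using extreme_point_of_face[OF face, of w] by (simp add: extreme_point_of_segment)
        moreover have "w \<in> convex hull S" using w by (simp add: hull_inc)
        ultimately show ?thesis using ab by force
      qed
      have "0 = a \<bullet> (v - u)" by (simp add: inner_diff_right au av)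
      also have "\<dots> = (\<Sum>w\<in>N. c w * (a \<bullet> w - b))"
        by (simp add: sum inner_sum_right inner_diff_right au)
      finally have "(\<Sum>w\<in>N. c w * (b - a \<bullet> w)) = 0"
        by (simp add: algebra_simps sum_subtractf)
      then have "\<forall>w\<in>N. c w * (b - a \<bullet> w) = 0"
        using N aw by (subst (asm) sum_nonneg_eq_0_iff) (auto simp: less_imp_le)
      then have "\<forall>w\<in>N. c w = 0" using aw by fastforce
      then show False using sum uv by simp
    qed
    with S show "u \<in> S \<and> v \<in> S \<and> u \<bullet> v = m" by blast
  next
    assume "u \<in> S \<and> v \<in> S \<and> u \<bullet> v = m"
    then have S: "u \<in> S" "v \<in> S" and uvm: "u \<bullet> v = m" by auto
    have uv: "u \<noteq> v" using sphere[OF S(1)] uvm \<open>m < r\<close> by auto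
    \<comment> \<open>By symmetry the outer normal of a supporting plane at an edge can be taken through its midpoint.\<close>
    define F where "F = convex hull S \<inter> {x. (u + v) \<bullet> x = r + m}"
    have w: "(u + v) \<bullet> w < r + m" if "w \<in> S" "w \<noteq> u" "w \<noteq> v" for w
      using far[of u w] far[of v w] that S \<open>m < r\<close> by (auto simp: inner_add_left)
    have uvF: "(u + v) \<bullet> u = r + m" "(u + v) \<bullet> v = r + m"
      using sphere[OF S(1)] sphere[OF S(2)] uvm
      by (simp_all add: inner_add_left inner_commute[of v u])
    have "S \<subseteq> {x. (u + v) \<bullet> x \<le> r + m}"
      using w uvF by (metis (mono_tags, lifting) less_eq_real_def mem_Collect_eq subsetI)
    then have "convex hull S \<subseteq> {x. (u + v) \<bullet> x \<le> r + m}"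
      by (simp add: hull_minimal convex_halfspace_le)
    then have F: "F face_of convex hull S"
      unfolding F_def by (intro face_of_Int_supporting_hyperplane_le) auto
    obtain S' where S': "S' \<subseteq> S" "F = convex hull S'"
      using face_of_convex_hull_subset[OF finite_imp_compact[OF fin] F] by blast
    have "S' \<subseteq> {u, v}"
    proof
      fix x assume x: "x \<in> S'"
      then have "x \<in> F" by (simp add: S' hull_inc)
      then show "x \<in> {u, v}" using w[of x] x S'(1) by (force simp: F_def)
    qed
    then have "F \<subseteq> closed_segment u v"
      unfolding S' segment_convex_hull by (rule hull_mono)
    moreover have "closed_segment u v \<subseteq> F"
      using S uvF face_of_imp_convex[OF F]
      by (intro closed_segment_subset) (auto simp: F_def hull_inc)
    ultimately have "F = closed_segment u v" by blast
    then show "closed_segment u v edge_of convex hull S"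
      using F uv by (simp add: edge_of_def segment_convex_hull aff_dim_convex_hull aff_dim_2)
  qed
qed


section \<open>Exact arithmetic with the golden ratio\<close>

text \<open>A pair \<open>(a, b)\<close> stands for \<open>a + b * golden_ratio\<close>. Since \<open>1 / golden_ratio = golden_ratio - 1\<close>,
every coordinate of the five solids has this form, so that all inner products can be computed with
integers.\<close>

type_synonym gint = "int \<times> int"
type_synonym gvec = "gint \<times> gint \<times> gint"

fun gval :: "gint \<Rightarrow> real" where
  "gval (a, b) = of_int a + of_int b * golden_ratio"

fun gadd :: "gint \<Rightarrow> gint \<Rightarrow> gint" where
  "gadd (a, b) (c, d) = (a + c, b + d)"

fun gdiff :: "gint \<Rightarrow> gint \<Rightarrow> gint" where
  "gdiff (a, b) (c, d) = (a - c, b - d)"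

fun gmult :: "gint \<Rightarrow> gint \<Rightarrow> gint" where
  "gmult (a, b) (c, d) = (a * c + b * d, a * d + b * c + b * d)"

text \<open>Only a sufficient condition for positivity: the number is positive with either of the bounds
\<open>8/5 < golden_ratio < 13/8\<close> (quotients of Fibonacci numbers) in place of the golden ratio. These
bounds are fine enough to decide every sign that occurs.\<close>

fun gpos :: "gint \<Rightarrow> bool" where
  "gpos (a, b) \<longleftrightarrow> 0 < 5 * a + 8 * b \<and> 0 < 8 * a + 13 * b"

definition gnonneg :: "gint \<Rightarrow> bool" where
  "gnonneg x \<longleftrightarrow> x = (0, 0) \<or> gpos x"

definition vec3 :: "gvec \<Rightarrow> real^3" where
  "vec3 = (\<lambda>(x, y, z). vector [gval x, gval y, gval z])"

fun vadd :: "gvec \<Rightarrow> gvec \<Rightarrow> gvec" where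
  "vadd (x, y, z) (x', y', z') = (gadd x x', gadd y y', gadd z z')"

fun vdiff :: "gvec \<Rightarrow> gvec \<Rightarrow> gvec" where
  "vdiff (x, y, z) (x', y', z') = (gdiff x x', gdiff y y', gdiff z z')"

fun vscale :: "gint \<Rightarrow> gvec \<Rightarrow> gvec" where
  "vscale c (x, y, z) = (gmult c x, gmult c y, gmult c z)"

fun vdot :: "gvec \<Rightarrow> gvec \<Rightarrow> gint" where
  "vdot (x, y, z) (x', y', z') = gadd (gmult x x') (gadd (gmult y y') (gmult z z'))"

lemma golden_ratio_square: "golden_ratio * golden_ratio = 1 + golden_ratio"
  by (simp add: golden_ratio_def field_simps)

lemma golden_ratio_bounds: "8 / 5 < golden_ratio" "golden_ratio < 13 / 8"
proof -
  have "sqrt 5 > sqrt ((11/5)\<^sup>2)" "sqrt 5 < sqrt ((9/4)\<^sup>2)"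
    by (subst real_sqrt_less_iff, simp add: power2_eq_square)+
  then show "8 / 5 < golden_ratio" "golden_ratio < 13 / 8"
    by (simp_all add: golden_ratio_def)
qed

lemma divide_golden_ratio: "x / golden_ratio = x * (golden_ratio - 1)"
proof -
  have "1 / golden_ratio = golden_ratio - 1"
    using golden_ratio_square golden_ratio_bounds by (simp add: field_simps)
  then show ?thesis by (metis mult.right_neutral times_divide_eq_right)
qed

lemma gval_gadd: "gval (gadd x y) = gval x + gval y"
  by (cases x; cases y) (simp add: algebra_simps)

lemma gval_gdiff: "gval (gdiff x y) = gval x - gval y"
  by (cases x; cases y) (simp add: algebra_simps)

lemma gval_gmult: "gval (gmult x y) = gval x * gval y"
proof (cases x, cases y)
  fix a b c d assume "x = (a, b)" "y = (c, d)"
  moreover have "of_int b * golden_ratio * (of_int d * golden_ratio)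
      = of_int (b * d) * (1 + golden_ratio)"
    by (simp flip: golden_ratio_square)
  ultimately show ?thesis by (simp add: algebra_simps)
qed

lemma gval_pos:
  assumes "gpos x"
  shows "0 < gval x"
proof (cases x)
  case (Pair a b)
  have "0 < real_of_int (5 * a + 8 * b)" "0 < real_of_int (8 * a + 13 * b)"
    using assms Pair by (simp_all only: of_int_0_less_iff gpos.simps)
  then have ab: "0 < 5 * of_int a + 8 * (of_int b :: real)"
      "0 < 8 * of_int a + 13 * (of_int b :: real)"
    by simp_all
  show ?thesis
  proof (cases "b \<ge> 0")
    case True
    then have "of_int b * (8 / 5) \<le> of_int b * golden_ratio"
      using golden_ratio_bounds by (intro mult_left_mono) auto
    then show ?thesis using ab Pair by simp
  next
    case False
    then have "of_int b * (13 / 8) \<le> of_int b * golden_ratio"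
      using golden_ratio_bounds by (intro mult_left_mono_neg) auto
    then show ?thesis using ab Pair by simp
  qed
qed

lemma gval_nonneg:
  assumes "gnonneg x"
  shows "0 \<le> gval x"
  using assms gval_pos[of x] by (auto simp: gnonneg_def)

lemma vec3_vadd: "vec3 (vadd x y) = vec3 x + vec3 y"
  by (cases x rule: prod_cases3; cases y rule: prod_cases3) (simp add: vec3_def vec_eq_iff forall_3 gval_gadd del: gval.simps)

lemma vec3_vdiff: "vec3 (vdiff x y) = vec3 x - vec3 y"
  by (cases x rule: prod_cases3; cases y rule: prod_cases3) (simp add: vec3_def vec_eq_iff forall_3 gval_gdiff del: gval.simps)

lemma vec3_vscale: "vec3 (vscale c x) = gval c *\<^sub>R vec3 x"
  by (cases x rule: prod_cases3) (simp add: vec3_def vec_eq_iff forall_3 gval_gmult del: gval.simps)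

lemma vec3_inner: "vec3 x \<bullet> vec3 y = gval (vdot x y)"
  by (cases x rule: prod_cases3; cases y rule: prod_cases3) (simp add: vec3_def inner_vec_def sum_3 gval_gadd gval_gmult del: gval.simps)


section \<open>A certificate for vertices and edges\<close>

text \<open>Where the coefficients come from: let \<open>u\<close> have \<open>n\<close> neighbours \<open>w\<close>. By rotational symmetry about the
axis of \<open>u\<close>, their sum is \<open>\<kappa> *\<^sub>R u\<close>, and the sum of \<open>(w \<bullet> v) *\<^sub>R w\<close> is
\<open>p *\<^sub>R v + (q * (u \<bullet> v)) *\<^sub>R u\<close> for all \<open>v\<close>. Looking for coefficients of \<open>w - u\<close> that are affine in
\<open>w \<bullet> v\<close> and \<open>u \<bullet> v\<close> and add up to \<open>v - u\<close> gives \<open>(\<gamma> * (r - u \<bullet> v) - (m - w \<bullet> v)) / p\<close> with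
\<open>\<gamma> = (\<kappa> - q) / (n - \<kappa>)\<close>. Clearing denominators with \<open>k = d * p\<close> and \<open>g = d * \<gamma>\<close> leads to the
definition below.

The checks are cut into small first-order functions, applied partially to lists, so that the
simplifier evaluates them on concrete arguments only and never unfolds them under a binder.\<close>

definition cone_coeff :: "gint \<Rightarrow> gint \<Rightarrow> gint \<Rightarrow> gint \<Rightarrow> gvec \<Rightarrow> gvec \<Rightarrow> gvec \<Rightarrow> gint" where
  "cone_coeff r m g d u v w =
    gdiff (gmult g (gdiff r (vdot u v))) (gmult d (gdiff m (vdot w v)))"

definition cone_term :: "gint \<Rightarrow> gint \<Rightarrow> gint \<Rightarrow> gint \<Rightarrow> gvec \<Rightarrow> gvec \<Rightarrow> gvec \<Rightarrow> gvec" where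
  "cone_term r m g d u v w = vscale (cone_coeff r m g d u v w) (vdiff w u)"

definition cone_coeff_ok :: "gint \<Rightarrow> gint \<Rightarrow> gint \<Rightarrow> gint \<Rightarrow> gvec \<Rightarrow> gvec \<Rightarrow> gvec \<Rightarrow> bool" where
  "cone_coeff_ok r m g d u v w \<longleftrightarrow> gnonneg (cone_coeff r m g d u v w)"

definition pair_ok ::
    "gint \<Rightarrow> gint \<Rightarrow> gint \<Rightarrow> gint \<Rightarrow> gint \<Rightarrow> gvec \<Rightarrow> gvec list \<Rightarrow> gvec \<Rightarrow> bool" where
  "pair_ok r m k g d u ns v \<longleftrightarrow> u = v \<or> vdot u v = m \<or>
    gpos (gdiff m (vdot u v)) \<and> list_all (cone_coeff_ok r m g d u v) ns \<and>
    vscale k (vdiff v u) = foldr vadd (map (cone_term r m g d u v) ns) ((0, 0), (0, 0), (0, 0))"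

definition row_ok ::
    "gint \<Rightarrow> gint \<Rightarrow> gint \<Rightarrow> gint \<Rightarrow> gint \<Rightarrow> gvec list \<Rightarrow> gvec \<Rightarrow> nat list \<Rightarrow> bool" where
  "row_ok r m k g d vs u l \<longleftrightarrow>
    vdot u u = r \<and> list_all (pair_ok r m k g d u (map ((!) vs) l)) vs"

definition adjacent_index :: "gint \<Rightarrow> gvec list \<Rightarrow> gvec \<Rightarrow> nat \<Rightarrow> bool" where
  "adjacent_index m vs u j \<longleftrightarrow> vdot u (vs ! j) = m"

definition adjacency_row :: "gint \<Rightarrow> gvec list \<Rightarrow> gvec \<Rightarrow> nat list" where
  "adjacency_row m vs u = filter (adjacent_index m vs u) [0..<length vs]"

definition edge_certificate ::
    "gvec list \<Rightarrow> nat list list \<Rightarrow> gint \<Rightarrow> gint \<Rightarrow> gint \<Rightarrow> gint \<Rightarrow> gint \<Rightarrow> bool" where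
  "edge_certificate vs N r m k g d \<longleftrightarrow>
    distinct vs \<and> gpos k \<and> gpos (gdiff r m) \<and>
    N = map (adjacency_row m vs) vs \<and> list_all2 (row_ok r m k g d vs) vs N"

text \<open>Vertices are replaced by indices, and row \<open>i\<close> of \<open>N\<close> lists the neighbours of the vertex \<open>i\<close>.\<close>

definition represents :: "'a sgraph \<Rightarrow> nat list list \<Rightarrow> (nat \<Rightarrow> 'a) \<Rightarrow> bool" where
  "represents G N p \<longleftrightarrow> bij_betw p {..<length N} (verts G) \<and>
    (\<forall>i<length N. \<forall>j<length N. {p i, p j} \<in> edges G \<longleftrightarrow> j \<in> set (N ! i))"
  

lemma vec3_foldr_vadd: "vec3 (foldr vadd xs ((0, 0), (0, 0), (0, 0))) = (\<Sum>x\<leftarrow>xs. vec3 x)"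
proof (induction xs)
  case Nil
  show ?case by (simp add: vec3_def vec_eq_iff forall_3)
qed (simp add: vec3_vadd)

lemma represents_edge_graph:
  assumes cert: "edge_certificate vs N r m k g d"
    and P: "P = convex hull (vec3 ` set vs)"
  shows "represents (edge_graph P) N (\<lambda>i. vec3 (vs ! i))"
proof -
  define nb where "nb u = map ((!) vs) (adjacency_row m vs u)" for u
  have dist: "distinct vs" and k: "0 < gval k" and mr: "gval m < gval r"
    and N: "N = map (adjacency_row m vs) vs"
    and rows: "list_all2 (row_ok r m k g d vs) vs N"
    using cert gval_pos[of k] gval_pos[of "gdiff r m"]
    by (auto simp: edge_certificate_def gval_gdiff simp del: gval.simps)
  have nb: "distinct (nb u)" "set (nb u) = {w \<in> set vs. vdot u w = m}" for u
    using dist by (auto simp: nb_def adjacency_row_def adjacent_index_def distinct_map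
        inj_on_nth in_set_conv_nth image_iff simp del: vdot.simps split_paired_All) metis
  have row: "vdot u u = r" "\<And>v. v \<in> set vs \<Longrightarrow> pair_ok r m k g d u (nb u) v"
    if u: "u \<in> set vs" for u
  proof -
    obtain i where i: "i < length vs" "vs ! i = u"
      using u unfolding in_set_conv_nth by blast
    have "row_ok r m k g d vs u (adjacency_row m vs u)"
      using list_all2_nthD[OF rows i(1)] unfolding N nth_map[OF i(1)] i(2) .
    then show "vdot u u = r" "\<And>v. v \<in> set vs \<Longrightarrow> pair_ok r m k g d u (nb u) v"
      unfolding row_ok_def nb_def list_all_iff by blast+
  qed
  define S where "S = vec3 ` set vs"
  have sphere: "v \<bullet> v = gval r" if "v \<in> S" for v
    using that row(1) by (auto simp: S_def vec3_inner simp del: gval.simps)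
  have less: "gval (vdot u v) < gval m"
    if "u \<in> set vs" "v \<in> set vs" "u \<noteq> v" "vdot u v \<noteq> m" for u v
    using row(2)[of u v] that gval_pos[of "gdiff m (vdot u v)"]
    by (auto simp: pair_ok_def gval_gdiff simp del: gval.simps)
  have far: "u \<bullet> v \<le> gval m" if "u \<in> S" "v \<in> S" "u \<noteq> v" for u v
    using that less by (auto simp: S_def vec3_inner simp del: gval.simps) (metis less_imp_le order_refl)
  have inj: "inj_on vec3 (set vs)"
  proof (rule inj_onI, rule ccontr)
    fix u v assume uv: "u \<in> set vs" "v \<in> set vs" "vec3 u = vec3 v" "u \<noteq> v"
    then have "gval (vdot u v) \<le> gval m" using less by fastforce
    then show False
      using uv mr row(1)[of v] vec3_inner[of u v] vec3_inner[of v v] by simp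
  qed
  have adj: "gval (vdot u v) = gval m \<longleftrightarrow> vdot u v = m" if "u \<in> set vs" "v \<in> set vs" for u v
  proof
    show "vdot u v = m" if eq: "gval (vdot u v) = gval m"
    proof (rule ccontr)
      assume ne: "vdot u v \<noteq> m"
      show False
        using eq less[OF \<open>u \<in> set vs\<close> \<open>v \<in> set vs\<close> _ ne] row(1)[OF \<open>u \<in> set vs\<close>] mr
        by (cases "u = v") auto
    qed
  qed simp
  have cone: "\<exists>M c. finite M \<and> M \<subseteq> {w \<in> S. u \<bullet> w = gval m} \<and> (\<forall>w\<in>M. 0 \<le> c w) \<and>
      v - u = (\<Sum>w\<in>M. c w *\<^sub>R (w - u))"
    if uv: "u \<in> S" "v \<in> S" "u \<noteq> v" "u \<bullet> v \<noteq> gval m" for u v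
  proof -
    obtain x y where xy: "x \<in> set vs" "y \<in> set vs" "u = vec3 x" "v = vec3 y"
      using uv unfolding S_def by blast
    have ok: "list_all (cone_coeff_ok r m g d x y) (nb x)"
      "vscale k (vdiff y x) = foldr vadd (map (cone_term r m g d x y) (nb x)) ((0, 0), (0, 0), (0, 0))"
      using row(2)[OF xy(1,2)] uv xy by (auto simp: pair_ok_def vec3_inner)
    define c where
      "c w = (gval g * (gval r - u \<bullet> v) - gval d * (gval m - w \<bullet> v)) / gval k" for w
    have coeff: "gval (cone_coeff r m g d x y w) = gval k * c (vec3 w)" for w
      using k by (simp add: cone_coeff_def c_def gval_gdiff gval_gmult vec3_inner xy del: gval.simps)
    have "gval k *\<^sub>R (v - u) = vec3 (vscale k (vdiff y x))"
      by (simp add: vec3_vscale vec3_vdiff xy)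
    also have "\<dots> = (\<Sum>w\<leftarrow>nb x. vec3 (cone_term r m g d x y w))"
      unfolding ok by (simp add: vec3_foldr_vadd o_def)
    also have "\<dots> = (\<Sum>w\<in>set (nb x). (gval k * c (vec3 w)) *\<^sub>R (vec3 w - u))"
      using nb by (simp add: sum_list_distinct_conv_sum_set cone_term_def vec3_vscale coeff
          vec3_vdiff xy del: gval.simps)
    also have "\<dots> = (\<Sum>w\<in>vec3 ` set (nb x). (gval k * c w) *\<^sub>R (w - u))"
      using inj nb by (subst sum.reindex) (auto intro: inj_on_subset)
    also have "\<dots> = gval k *\<^sub>R (\<Sum>w\<in>vec3 ` set (nb x). c w *\<^sub>R (w - u))"
      by (simp add: scaleR_sum_right)
    finally have "v - u = (\<Sum>w\<in>vec3 ` set (nb x). c w *\<^sub>R (w - u))"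
      using k by simp
    moreover have "\<forall>w\<in>vec3 ` set (nb x). 0 \<le> c w"
    proof
      fix w assume "w \<in> vec3 ` set (nb x)"
      then obtain z where z: "z \<in> set (nb x)" "w = vec3 z" by blast
      then have "0 \<le> gval (cone_coeff r m g d x y z)"
        using ok(1) by (intro gval_nonneg) (auto simp: list_all_iff cone_coeff_ok_def)
      then show "0 \<le> c w" using k by (simp add: coeff z zero_le_mult_iff)
    qed
    moreover have "vec3 ` set (nb x) \<subseteq> {w \<in> S. u \<bullet> w = gval m}"
      using nb by (auto simp: S_def xy vec3_inner)
    ultimately show ?thesis by blast
  qed
  have edge: "closed_segment u v edge_of P \<longleftrightarrow> u \<in> S \<and> v \<in> S \<and> u \<bullet> v = gval m" for u v
    unfolding P S_def[symmetric]
    using closed_segment_edge_of_hull_iff[OF _ sphere mr far cone] by (simp add: S_def)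
  have edges: "{u, v} \<in> edges (edge_graph P) \<longleftrightarrow> u \<in> S \<and> v \<in> S \<and> u \<bullet> v = gval m" for u v
    by (auto simp: edge_graph_def edge doubleton_eq_iff inner_commute)
  have "verts (edge_graph P) = S"
    using extreme_points_of_hull_in_sphere[OF sphere, of S]
    by (simp add: edge_graph_def P S_def)
  moreover have "bij_betw (\<lambda>i. vec3 (vs ! i)) {..<length vs} S"
    unfolding S_def
    using bij_betw_trans[OF bij_betw_nth[OF dist refl refl] inj_on_imp_bij_betw[OF inj]]
    by (simp add: o_def)
  moreover have "{vec3 (vs ! i), vec3 (vs ! j)} \<in> edges (edge_graph P) \<longleftrightarrow> j \<in> set (N ! i)"
    if "i < length vs" "j < length vs" for i j
    unfolding edges using that adj[of "vs ! i" "vs ! j"]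
    by (simp add: N S_def vec3_inner adjacency_row_def adjacent_index_def del: gval.simps)
  ultimately show ?thesis by (simp add: represents_def N)
qed


section \<open>Equitable bipartitions of regular graphs\<close>

definition regular_graph :: "nat list list \<Rightarrow> nat \<Rightarrow> bool" where
  "regular_graph N k \<longleftrightarrow> N \<noteq> [] \<and> (\<forall>i\<in>{..<length N}. distinct (N ! i) \<and> length (N ! i) = k \<and>
    (\<forall>j\<in>set (N ! i). j < length N \<and> i \<in> set (N ! j)))"

text \<open>A perfect 2-colouring, given by its first class \<open>C\<close>. In a regular graph the two off-diagonal numbers
\<open>b\<close> and \<open>c\<close> determine the colour adjacency matrix.\<close>

definition perfect_split :: "nat list list \<Rightarrow> nat set \<Rightarrow> nat \<Rightarrow> nat \<Rightarrow> bool" where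
  "perfect_split N C b c \<longleftrightarrow> C \<subseteq> {..<length N} \<and> C \<noteq> {} \<and> C \<noteq> {..<length N} \<and>
    (\<forall>i\<in>C. card (set (N ! i) - C) = b) \<and> (\<forall>i\<in>{..<length N} - C. card (set (N ! i) \<inter> C) = c)"

lemma regular_graphD:
  assumes "regular_graph N k" "i < length N"
  shows "distinct (N ! i)" "set (N ! i) \<subseteq> {..<length N}" "card (set (N ! i)) = k"
    "\<And>j. j \<in> set (N ! i) \<Longrightarrow> i \<in> set (N ! j)"
proof -
  have "distinct (N ! i) \<and> length (N ! i) = k \<and>
      (\<forall>j\<in>set (N ! i). j < length N \<and> i \<in> set (N ! j))"
    by (rule bspec[OF conjunct2[OF assms(1)[unfolded regular_graph_def]]])
      (simp only: lessThan_iff assms(2))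
  then have row: "distinct (N ! i)" "length (N ! i) = k"
    "\<forall>j\<in>set (N ! i). j < length N \<and> i \<in> set (N ! j)"
    by blast+
  show "distinct (N ! i)" by (rule row)
  show "set (N ! i) \<subseteq> {..<length N}" using row(3) by blast
  show "card (set (N ! i)) = k" using distinct_card[OF row(1)] row(2) by metis
  show "i \<in> set (N ! j)" if "j \<in> set (N ! i)" for j using row(3) that by blast
qed

lemma perfect_split_complement:
  assumes reg: "regular_graph N k" and split: "perfect_split N C b c"
  shows "perfect_split N ({..<length N} - C) c b"
  unfolding perfect_split_def
proof (intro conjI ballI)
  have C: "C \<subseteq> {..<length N}" "C \<noteq> {}" "C \<noteq> {..<length N}"
    and out: "\<And>i. i \<in> C \<Longrightarrow> card (set (N ! i) - C) = b"
    and inn: "\<And>i. i \<in> {..<length N} - C \<Longrightarrow> card (set (N ! i) \<inter> C) = c"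
    using split by (simp_all add: perfect_split_def)
  show "{..<length N} - C \<noteq> {}" "{..<length N} - C \<noteq> {..<length N}" using C by blast+
  fix i
  have sub: "set (N ! i) \<subseteq> {..<length N}" if "i < length N"
    using reg that by (rule regular_graphD(2))
  show "card (set (N ! i) - ({..<length N} - C)) = c" if i: "i \<in> {..<length N} - C"
  proof -
    have "set (N ! i) - ({..<length N} - C) = set (N ! i) \<inter> C" using sub i by blast
    then show ?thesis using inn[OF i] by simp
  qed
  show "card (set (N ! i) \<inter> ({..<length N} - C)) = b"
    if "i \<in> {..<length N} - ({..<length N} - C)"
  proof -
    have i: "i \<in> C" using that by blast
    then have "set (N ! i) \<inter> ({..<length N} - C) = set (N ! i) - C" using sub C by blast
    then show ?thesis using out[OF i] by simp
  qed
qed blast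

text \<open>The adjacency operator of an undirected graph is self-adjoint.\<close>

lemma sum_neighbors_swap:
  fixes f h :: "nat \<Rightarrow> int"
  assumes "regular_graph N k"
  shows "(\<Sum>i<length N. (\<Sum>j\<in>set (N ! i). h j) * f i) =
    (\<Sum>j<length N. h j * (\<Sum>i\<in>set (N ! j). f i))"
proof -
  have sub: "set (N ! i) = {j \<in> {..<length N}. j \<in> set (N ! i)}" if "i < length N" for i
    using regular_graphD(2)[OF assms that] by blast
  have restrict: "(\<Sum>j\<in>set (N ! i). q j) = (\<Sum>j<length N. if j \<in> set (N ! i) then q j else 0)"
    if "i < length N" for i and q :: "nat \<Rightarrow> int"
    by (subst sub[OF that]) (rule sum.inter_filter, simp)
  have sym: "j \<in> set (N ! i) \<longleftrightarrow> i \<in> set (N ! j)" if "i < length N" "j < length N" for i j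
    using regular_graphD(4)[OF assms] that by blast
  have "(\<Sum>i<length N. (\<Sum>j\<in>set (N ! i). h j) * f i) =
      (\<Sum>i<length N. \<Sum>j<length N. if j \<in> set (N ! i) then h j * f i else 0)"
    by (intro sum.cong) (auto simp: restrict sum_distrib_right intro!: sum.cong)
  also have "\<dots> = (\<Sum>j<length N. \<Sum>i<length N. if j \<in> set (N ! i) then h j * f i else 0)"
    by (rule sum.swap)
  also have "\<dots> = (\<Sum>j<length N. h j * (\<Sum>i\<in>set (N ! j). f i))"
    by (intro sum.cong) (auto simp: restrict sum_distrib_left sym intro!: sum.cong)
  finally show ?thesis .
qed

text \<open>Integer vectors indexed by the vertices: \<open>walk_step\<close> applies the adjacency matrix, and \<open>walk_poly\<close>
applies, by Horner's rule, the polynomial with the given coefficients (constant term first) in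
the adjacency matrix to the unit vector at the vertex \<open>0\<close>. One column of a matrix polynomial is all
that is needed, because the eigenvector of a colouring vanishes nowhere.\<close>

definition walk_step :: "nat list list \<Rightarrow> int list \<Rightarrow> int list" where
  "walk_step N h = map (\<lambda>l. sum_list (map ((!) h) l)) N"

fun add_at_head :: "int \<Rightarrow> int list \<Rightarrow> int list" where
  "add_at_head a [] = []"
| "add_at_head a (x # xs) = (a + x) # xs"

fun walk_poly :: "nat list list \<Rightarrow> int list \<Rightarrow> int list" where
  "walk_poly N [] = replicate (length N) 0"
| "walk_poly N (a # as) = add_at_head a (walk_step N (walk_poly N as))"

lemma length_walk_poly: "length (walk_poly N as) = length N"
proof (induction as)
  case (Cons a as)
  have "length (add_at_head a xs) = length xs" for xs by (cases xs) auto
  then show ?case by (simp add: walk_step_def)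
qed simp

text \<open>On an eigenvector with eigenvalue \<open>l\<close>, self-adjointness moves every factor of the adjacency matrix
to the other side, where it acts as multiplication by \<open>l\<close>.\<close>

lemma walk_poly_pairing:
  assumes reg: "regular_graph N k"
    and eigen: "\<And>i. i < length N \<Longrightarrow> (\<Sum>j\<in>set (N ! i). f j) = l * f i"
  shows "(\<Sum>i<length N. walk_poly N as ! i * f i) = f 0 * horner_sum id l as"
proof (induction as)
  case Nil
  show ?case by simp
next
  case (Cons a as)
  have head: "(\<Sum>i<length xs. add_at_head a xs ! i * f i) = a * f 0 + (\<Sum>i<length xs. xs ! i * f i)"
    if "xs \<noteq> []" for xs
    using that by (cases xs) (simp_all add: sum.lessThan_Suc_shift algebra_simps del: sum.lessThan_Suc)
  let ?h = "walk_poly N as"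
  have len: "length (walk_step N ?h) = length N" by (simp add: walk_step_def)
  have ne: "walk_step N ?h \<noteq> []" using reg by (simp add: walk_step_def regular_graph_def)
  have "(\<Sum>i<length N. walk_step N ?h ! i * f i) =
      (\<Sum>i<length N. (\<Sum>j\<in>set (N ! i). ?h ! j) * f i)"
    by (intro sum.cong) (auto simp: walk_step_def sum_list_distinct_conv_sum_set
        regular_graphD(1)[OF reg])
  also have "\<dots> = (\<Sum>j<length N. ?h ! j * (l * f j))"
    by (simp add: sum_neighbors_swap[OF reg] eigen)
  also have "\<dots> = l * (\<Sum>j<length N. ?h ! j * f j)"
    by (simp add: sum_distrib_left algebra_simps)
  finally show ?case
    using head[OF ne] len Cons.IH by (simp add: algebra_simps)
qed

text \<open>The Hoffman identity \<open>hoffman\<close> plays a double role: it makes the eigenvalue \<open>k - b - c\<close> a root, and it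
forces the graph to be connected, so that \<open>b\<close> and \<open>c\<close> cannot vanish.\<close>

lemma perfect_split_constraints:
  assumes reg: "regular_graph N k" and split: "perfect_split N C b c"
    and hoffman: "walk_poly N as = replicate (length N) \<kappa>" "\<kappa> \<noteq> 0"
  shows "card C * b = (length N - card C) * c" "b \<in> {1..k}" "c \<in> {1..k}"
    "horner_sum id (int k - int b - int c) as = 0"
proof -
  let ?n = "length N"
  have C: "C \<subseteq> {..<?n}" "C \<noteq> {}" "C \<noteq> {..<?n}" using split by (auto simp: perfect_split_def)
  have finC: "finite C" using C finite_subset by blast
  have n: "0 < ?n" using reg by (simp add: regular_graph_def)
  have out: "card (set (N ! i) - C) = b" if "i \<in> C" for i
    using split that by (auto simp: perfect_split_def)
  have inn: "card (set (N ! i) \<inter> C) = c" if "i < ?n" "i \<notin> C" for i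
    using split that by (auto simp: perfect_split_def)
  have deg: "card (set (N ! i) \<inter> C) + card (set (N ! i) - C) = k" if "i < ?n" for i
    using regular_graphD(3)[OF reg that] card_Int_Diff[of "set (N ! i)" C] by simp
  have root: "f 0 * horner_sum id l as = \<kappa> * (\<Sum>i<?n. f i)"
    if "\<And>i. i < ?n \<Longrightarrow> (\<Sum>j\<in>set (N ! i). f j) = l * f i" for f l
    using walk_poly_pairing[OF reg that, of as] by (simp add: hoffman sum_distrib_left)
  obtain x y where xy: "x \<in> C" "y < ?n" "y \<notin> C" using C by blast
  have bk: "b \<le> k" using deg[of x] out[of x] xy C by auto
  have ck: "c \<le> k" using deg[of y] inn[of y] xy by auto
  have pos: "b \<noteq> 0 \<or> c \<noteq> 0"
  proof (rule ccontr)
    assume "\<not> (b \<noteq> 0 \<or> c \<noteq> 0)"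
    then have bc: "b = 0" "c = 0" by auto
    \<comment> \<open>Without edges between the colours, the indicator of the colour that misses the vertex \<open>0\<close> would be
      an eigenvector for \<open>k\<close> that vanishes at \<open>0\<close> although its sum is positive.\<close>
    define f :: "nat \<Rightarrow> int" where "f i = (if (i \<in> C) = (0 \<in> C) then 0 else 1)" for i
    have "f j = f i" if "i < ?n" "j \<in> set (N ! i)" for i j
      using out[of i] inn[of i] that bc by (auto simp: f_def split: if_splits)
    then have "(\<Sum>j\<in>set (N ! i). f j) = int k * f i" if "i < ?n" for i
      using regular_graphD(3)[OF reg that] that by simp
    from root[OF this] have "(\<Sum>i<?n. f i) = 0" using hoffman by (simp add: f_def)
    then have "\<forall>i\<in>{..<?n}. f i = 0"
      by (subst (asm) sum_nonneg_eq_0_iff) (auto simp: f_def)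
    then have "f x = 0" "f y = 0" using xy C by auto
    then show False using xy by (auto simp: f_def split: if_splits)
  qed
  define f :: "nat \<Rightarrow> int" where "f i = (if i \<in> C then int b else - int c)" for i
  let ?l = "int k - int b - int c"
  have eigen: "(\<Sum>j\<in>set (N ! i). f j) = ?l * f i" if i: "i < ?n" for i
  proof -
    have "(\<Sum>j\<in>set (N ! i). f j) = (\<Sum>j\<in>set (N ! i) \<inter> C. f j) + (\<Sum>j\<in>set (N ! i) - C. f j)"
      by (rule sum.Int_Diff) simp
    also have "\<dots> = int b * int (card (set (N ! i) \<inter> C)) - int c * int (card (set (N ! i) - C))"
      by (simp add: f_def)
    finally have sum: "(\<Sum>j\<in>set (N ! i). f j) =
        int b * int (card (set (N ! i) \<inter> C)) - int c * int (card (set (N ! i) - C))" .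
    show ?thesis
    proof (cases "i \<in> C")
      case True
      have rest: "int (card (set (N ! i) \<inter> C)) = int k - int b"
        using deg[OF i] out[OF True] by linarith
      then show ?thesis
        unfolding sum out[OF True] rest using True by (simp add: f_def algebra_simps)
    next
      case False
      have rest: "int (card (set (N ! i) - C)) = int k - int c"
        using deg[OF i] inn[OF i False] by linarith
      then show ?thesis
        unfolding sum inn[OF i False] rest using False by (simp add: f_def algebra_simps)
    qed
  qed
  have "(\<Sum>i<?n. (\<Sum>j\<in>set (N ! i). 1) * f i) = (\<Sum>j<?n. 1 * (\<Sum>i\<in>set (N ! j). f i))"
    by (rule sum_neighbors_swap[OF reg])
  then have "int k * (\<Sum>i<?n. f i) = ?l * (\<Sum>i<?n. f i)"
    by (simp add: regular_graphD(3)[OF reg] eigen sum_distrib_left)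
  then have "(int b + int c) * (\<Sum>i<?n. f i) = 0"
    by (simp add: algebra_simps)
  \<comment> \<open>Eigenvectors for \<open>k\<close> and for \<open>k - b - c\<close> are orthogonal; for the constant vector this is the double
    count of the edges between the two colours.\<close>
  then have f0: "(\<Sum>i<?n. f i) = 0" using pos by auto
  have "(\<Sum>i<?n. f i) = (\<Sum>i\<in>{..<?n} - C. f i) + (\<Sum>i\<in>C. f i)"
    by (rule sum.subset_diff[OF C(1)]) simp
  also have "\<dots> = int (card C * b) - int ((?n - card C) * c)"
    using C finC by (simp add: f_def card_Diff_subset)
  finally show count: "card C * b = (?n - card C) * c" using f0 by linarith
  have "0 < card C" using C finC by (simp add: card_gt_0_iff)
  moreover have "card C < ?n" using psubset_card_mono[of "{..<?n}" C] C by auto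
  moreover have "card C * b = 0 \<longleftrightarrow> (?n - card C) * c = 0" using count by simp
  ultimately have "b \<noteq> 0" "c \<noteq> 0" using pos by auto
  then show "b \<in> {1..k}" "c \<in> {1..k}" using bk ck by auto
  have "f 0 \<noteq> 0" using \<open>b \<noteq> 0\<close> \<open>c \<noteq> 0\<close> by (simp add: f_def)
  then show "horner_sum id ?l as = 0"
    using root[OF eigen] f0 by simp
qed


section \<open>Colour adjacency matrices\<close>

lemma mat2_nth [simp]:
  "mat2 a b c d $ 1 $ 1 = a" "mat2 a b c d $ 1 $ 2 = b"
  "mat2 a b c d $ 2 $ 1 = c" "mat2 a b c d $ 2 $ 2 = d"
  by (simp_all add: mat2_def)

lemma mat2_eq_iff:
  "A = mat2 a b c d \<longleftrightarrow> A $ 1 $ 1 = a \<and> A $ 1 $ 2 = b \<and> A $ 2 $ 1 = c \<and> A $ 2 $ 2 = d"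
  by (auto simp: vec_eq_iff forall_2)

lemma perfect_2_coloring_matrix_iff:
  fixes G :: "'a sgraph"
  assumes rep: "represents G N p" and reg: "regular_graph N k"
  shows "perfect_2_coloring_matrix G A \<longleftrightarrow> (\<exists>C b c. perfect_split N C b c \<and>
    A = mat2 (real k - real b) (real b) (real c) (real k - real c))"
proof -
  let ?n = "length N"
  have bij: "bij_betw p {..<?n} (verts G)"
    and edge: "\<And>i j. i < ?n \<Longrightarrow> j < ?n \<Longrightarrow> {p i, p j} \<in> edges G \<longleftrightarrow> j \<in> set (N ! i)"
    using rep by (auto simp: represents_def)
  have inj: "inj_on p {..<?n}" and img: "p ` {..<?n} = verts G"
    using bij by (auto simp: bij_betw_def)
  have nb: "card (neighbors_in G (p ` D) (p i)) = card (set (N ! i) \<inter> D)"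
    if "i < ?n" "D \<subseteq> {..<?n}" for i D
  proof -
    have "neighbors_in G (p ` D) (p i) = p ` (set (N ! i) \<inter> D)"
      using that edge by (auto simp: neighbors_in_def)
    moreover have "inj_on p (set (N ! i) \<inter> D)"
      using that by (intro inj_on_subset[OF inj]) auto
    ultimately show ?thesis by (simp add: card_image)
  qed
  have deg: "card (set (N ! i) \<inter> C) + card (set (N ! i) - C) = k" if "i < ?n" for i C
    using regular_graphD(3)[OF reg that] card_Int_Diff[of "set (N ! i)" C] by simp
  have compl: "set (N ! i) \<inter> ({..<?n} - C) = set (N ! i) - C" if "i < ?n" for i C
    using regular_graphD(2)[OF reg that] by auto
  show ?thesis
  proof
    assume "perfect_2_coloring_matrix G A"
    then obtain W :: "2 \<Rightarrow> 'a set" where W: "coloring G W" "color_adjacency_matrix_of G W A"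
      by (auto simp: perfect_2_coloring_matrix_def perfect_coloring_def)
    have "W 1 \<union> W 2 = verts G" "W 1 \<inter> W 2 = {}" "W 1 \<noteq> {}" "W 2 \<noteq> {}"
      using W(1) by (auto simp: coloring_def disjoint_family_on_def UNIV_2)
    note W' = this
    define C where "C = {i \<in> {..<?n}. p i \<in> W 1}"
    have C: "C \<subseteq> {..<?n}" by (auto simp: C_def)
    have W1: "W 1 = p ` C"
      using W'(1) img by (auto simp: C_def)
    have W2: "W 2 = p ` ({..<?n} - C)"
    proof -
      have "W 2 = p ` {..<?n} - p ` C" using W'(1,2) img W1 by blast
      then show ?thesis using C inj by (simp add: inj_on_image_set_diff)
    qed
    have A1: "A $ 1 $ 1 = card (set (N ! i) \<inter> C)" "A $ 1 $ 2 = card (set (N ! i) - C)"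
      if "i \<in> C" for i
      using W(2) that C by (auto simp: color_adjacency_matrix_of_def W1 W2 nb compl forall_2 subset_iff)
    have A2: "A $ 2 $ 1 = card (set (N ! i) \<inter> C)" "A $ 2 $ 2 = card (set (N ! i) - C)"
      if "i < ?n" "i \<notin> C" for i
      using W(2) that C by (auto simp: color_adjacency_matrix_of_def W1 W2 nb compl forall_2)
    obtain x y where xy: "x \<in> C" "y < ?n" "y \<notin> C"
      using W' W1 W2 by auto
    define b c where "b = card (set (N ! x) - C)" and "c = card (set (N ! y) \<inter> C)"
    have "card (set (N ! i) - C) = b" if "i \<in> C" for i
      using A1(2)[OF that] A1(2)[OF xy(1)] by (simp add: b_def)
    moreover have "card (set (N ! i) \<inter> C) = c" if "i < ?n" "i \<notin> C" for i
      using A2(1)[OF that] A2(1)[OF xy(2,3)] by (simp add: c_def)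
    ultimately have "perfect_split N C b c"
      using xy C by (auto simp: perfect_split_def)
    moreover have "A = mat2 (real k - real b) (real b) (real c) (real k - real c)"
      using xy C A1[of x] A2[of y] deg[of x C] deg[of y C]
      by (auto simp: mat2_eq_iff b_def c_def)
    ultimately show "\<exists>C b c. perfect_split N C b c \<and>
      A = mat2 (real k - real b) (real b) (real c) (real k - real c)" by blast
  next
    assume "\<exists>C b c. perfect_split N C b c \<and>
      A = mat2 (real k - real b) (real b) (real c) (real k - real c)"
    then obtain C b c where split: "perfect_split N C b c"
      and A: "A = mat2 (real k - real b) (real b) (real c) (real k - real c)" by blast
    have C: "C \<subseteq> {..<?n}" "C \<noteq> {}" "C \<noteq> {..<?n}"
      using split by (auto simp: perfect_split_def)
    have out: "card (set (N ! i) - C) = b" if "i \<in> C" for i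
      using split that by (auto simp: perfect_split_def)
    have inn: "card (set (N ! i) \<inter> C) = c" if "i < ?n" "i \<notin> C" for i
      using split that by (auto simp: perfect_split_def)
    define W :: "2 \<Rightarrow> 'a set" where "W i = (if i = 1 then p ` C else p ` ({..<?n} - C))" for i
    have W: "W 1 = p ` C" "W 2 = p ` ({..<?n} - C)" by (auto simp: W_def)
    have disj: "p ` C \<inter> p ` ({..<?n} - C) = {}"
      using inj C by (auto simp: inj_on_def subset_iff)
    have "W i \<noteq> {}" for i using C by (auto simp: W_def)
    then have "coloring G W"
      unfolding coloring_def disjoint_family_on_def
      using C disj by (auto simp: UNIV_2 W img[symmetric])
    moreover have cam: "color_adjacency_matrix_of G W A"
    proof -
      have "real (card (set (N ! i) \<inter> C)) = real k - real b" if "i \<in> C" for i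
        using deg[of i C] out[OF that] that C by auto
      moreover have "real (card (set (N ! i) - C)) = real k - real c" if "i < ?n" "i \<notin> C" for i
        using deg[of i C] inn[OF that] that by auto
      ultimately show ?thesis
        using C out inn
        by (auto simp: color_adjacency_matrix_of_def forall_2 W A nb compl subset_iff)
    qed
    moreover have "\<exists>a. \<forall>v\<in>W i. card (neighbors_in G (W j) v) = a" for i j
    proof -
      have "\<forall>v\<in>W i. real (card (neighbors_in G (W j) v)) = A $ i $ j"
        using cam by (auto simp: color_adjacency_matrix_of_def)
      then show ?thesis by (metis of_nat_eq_iff)
    qed
    ultimately show "perfect_2_coloring_matrix G A"
      by (auto simp: perfect_2_coloring_matrix_def perfect_coloring_def)
  qed
qed

lemma permutes_UNIV_2:
  "p permutes (UNIV :: 2 set) \<longleftrightarrow> p = id \<or> p = Transposition.transpose 1 2"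
proof
  assume p: "p permutes (UNIV :: 2 set)"
  then have "inj p" by (simp add: permutes_inj)
  then have "p 1 \<noteq> p 2" by (simp add: inj_eq)
  then show "p = id \<or> p = Transposition.transpose 1 2"
    using exhaust_2[of "p 1"] exhaust_2[of "p 2"]
    by (auto simp: fun_eq_iff forall_2)
qed (auto simp: permutes_id permutes_swap_id)

text \<open>The only nontrivial permutation matrix of size 2 is an involution, hence its own inverse.\<close>

lemma equivalent_mat2_iff:
  "equivalent_matrices A (mat2 a b c d) \<longleftrightarrow> A = mat2 a b c d \<or> A = mat2 d c b a"
proof -
  define Q :: "real^2^2" where "Q = (\<chi> i j. if j = Transposition.transpose 1 2 i then 1 else 0)"
  have one: "(\<chi> i j. if j = id i then 1 else 0) = (mat 1 :: real^2^2)"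
    by (simp add: mat_def vec_eq_iff)
  have Q: "Q = mat2 0 1 1 0"
    by (simp add: Q_def mat2_eq_iff)
  have matrix_inv: "matrix_inv X = X" if "X ** X = mat 1" for X :: "real^2^2"
  proof -
    have "X ** matrix_inv X = mat 1 \<and> matrix_inv X ** X = mat 1"
      unfolding matrix_inv_def
      by (rule someI[where P = "\<lambda>Y. X ** Y = mat 1 \<and> Y ** X = mat 1" and x = X])
        (simp add: that)
    then show ?thesis by (metis that matrix_mul_assoc matrix_mul_lid matrix_mul_rid)
  qed
  have QQ: "Q ** Q = mat 1"
    by (simp add: Q matrix_matrix_mult_def mat_def vec_eq_iff forall_2 sum_2)
  have inv: "matrix_inv Q = Q" by (rule matrix_inv[OF QQ])
  have inv1: "matrix_inv (mat 1 :: real^2^2) = mat 1" by (rule matrix_inv) simp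
  have perm: "permutation_matrix P \<longleftrightarrow> P = mat 1 \<or> P = Q" for P :: "real^2^2"
    unfolding permutation_matrix_def permutes_UNIV_2 Q_def one[symmetric] by blast
  have QAQ: "Q ** A ** Q = mat2 (A $ 2 $ 2) (A $ 2 $ 1) (A $ 1 $ 2) (A $ 1 $ 1)"
    by (simp add: Q mat2_eq_iff matrix_matrix_mult_def sum_2)
  have "mat2 a b c d = Q ** A ** Q \<longleftrightarrow> A = mat2 d c b a"
    unfolding QAQ by (auto simp: mat2_eq_iff)
  moreover have "equivalent_matrices A B \<longleftrightarrow> B = A \<or> B = Q ** A ** Q" for B
    unfolding equivalent_matrices_def perm by (auto simp: inv inv1)
  ultimately show ?thesis by auto
qed

section \<open>The five solids\<close>

lemma Collect_eq_UN_image2: "{f x y |x y. x \<in> A \<and> y \<in> B} = (\<Union>x\<in>A. f x ` B)"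
  by blast

lemma Collect_eq_UN_image3: "{f x y z |x y z. x \<in> A \<and> y \<in> B \<and> z \<in> C} = (\<Union>x\<in>A. \<Union>y\<in>B. f x y ` C)"
  by blast

lemma mat2_of_splits:
  assumes "represents G N p" "regular_graph N k"
    and "\<And>b c. (\<exists>C. perfect_split N C b c) \<longleftrightarrow> (b, c) \<in> L"
  shows "perfect_2_coloring_matrix G A \<longleftrightarrow>
    (\<exists>(b, c)\<in>L. A = mat2 (real k - real b) (real b) (real c) (real k - real c))"
  unfolding perfect_2_coloring_matrix_iff[OF assms(1,2)] using assms(3) by fastforce

text \<open>In the identities \<open>*_hoffman\<close>, the polynomials are, in the order of the solids, \<open>x + 1\<close>,
\<open>(x - 1) * (x + 1) * (x + 3)\<close>, \<open>x * (x + 2)\<close>, \<open>(x\<^sup>2 - 5) * (x - 1) * x * (x + 2)\<close> and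
\<open>(x\<^sup>2 - 5) * (x + 1)\<close>: their roots are the eigenvalues other than the degree.\<close>

subsection \<open>The tetrahedron\<close>

definition tetrahedron_vertices :: "gvec list" where
  "tetrahedron_vertices = [
    ((1, 0), (1, 0), (1, 0)), ((1, 0), (-1, 0), (-1, 0)), ((-1, 0), (1, 0), (-1, 0)),
    ((-1, 0), (-1, 0), (1, 0))]"

definition tetrahedron_adj :: "nat list list" where
  "tetrahedron_adj = [
    [1, 2, 3], [0, 2, 3], [0, 1, 3], [0, 1, 2]]"

lemma tetrahedron_eq_hull: "tetrahedron = convex hull (vec3 ` set tetrahedron_vertices)"
  by (simp add: tetrahedron_def tetrahedron_vertices_def vec3_def)

lemma tetrahedron_represents:
  "represents (edge_graph tetrahedron) tetrahedron_adj (\<lambda>i. vec3 (tetrahedron_vertices ! i))"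
proof (rule represents_edge_graph[OF _ tetrahedron_eq_hull])
  show "edge_certificate tetrahedron_vertices tetrahedron_adj (3, 0) (-1, 0) (4, 0) (0, 0) (1, 0)"
    by code_simp
qed

lemma tetrahedron_length: "length tetrahedron_adj = 4"
  by code_simp

lemma tetrahedron_regular: "regular_graph tetrahedron_adj 3"
  by code_simp

lemma tetrahedron_hoffman:
  "walk_poly tetrahedron_adj [1, 1] = replicate (length tetrahedron_adj) 1"
  by code_simp

lemma tetrahedron_splits:
  "(\<exists>C. perfect_split tetrahedron_adj C b c) \<longleftrightarrow> (b, c) \<in> {(3, 1), (1, 3), (2, 2)}"
proof
  assume "\<exists>C. perfect_split tetrahedron_adj C b c"
  then obtain C where split: "perfect_split tetrahedron_adj C b c" by blast
  note constraints =
    perfect_split_constraints[OF tetrahedron_regular split tetrahedron_hoffman one_neq_zero]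
  have "b \<in> {1, 2, 3}" "c \<in> {1, 2, 3}"
    using constraints(2,3) by auto
  moreover have "card C * b = (4 - card C) * c"
    using constraints(1) unfolding tetrahedron_length .
  ultimately show "(b, c) \<in> {(3, 1), (1, 3), (2, 2)}"
    using constraints(4) by auto
next
  have c1: "perfect_split tetrahedron_adj (set [0]) 3 1"
    by code_simp
  have c2: "perfect_split tetrahedron_adj (set [0, 1]) 2 2"
    by code_simp
  assume "(b, c) \<in> {(3, 1), (1, 3), (2, 2)}"
  then show "\<exists>C. perfect_split tetrahedron_adj C b c"
    using c1 c2 perfect_split_complement[OF tetrahedron_regular c1]
    by auto
qed


subsection \<open>The cube\<close>

definition cube_vertices :: "gvec list" where
  "cube_vertices = [
    ((1, 0), (1, 0), (1, 0)), ((1, 0), (1, 0), (-1, 0)), ((1, 0), (-1, 0), (1, 0)),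
    ((1, 0), (-1, 0), (-1, 0)), ((-1, 0), (1, 0), (1, 0)), ((-1, 0), (1, 0), (-1, 0)),
    ((-1, 0), (-1, 0), (1, 0)), ((-1, 0), (-1, 0), (-1, 0))]"

definition cube_adj :: "nat list list" where
  "cube_adj = [
    [1, 2, 4], [0, 3, 5], [0, 3, 6], [1, 2, 7], [0, 5, 6],
    [1, 4, 7], [2, 4, 7], [3, 5, 6]]"

lemma cube_eq_hull: "cube = convex hull (vec3 ` set cube_vertices)"
  unfolding cube_def Collect_eq_UN_image2 Collect_eq_UN_image3
  by (simp add: cube_vertices_def vec3_def divide_golden_ratio insert_commute)

lemma cube_represents:
  "represents (edge_graph cube) cube_adj (\<lambda>i. vec3 (cube_vertices ! i))"
proof (rule represents_edge_graph[OF _ cube_eq_hull])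
  show "edge_certificate cube_vertices cube_adj (3, 0) (1, 0) (4, 0) (1, 0) (1, 0)"
    by code_simp
qed

lemma cube_length: "length cube_adj = 8"
  by code_simp

lemma cube_regular: "regular_graph cube_adj 3"
  by code_simp

lemma cube_hoffman:
  "walk_poly cube_adj [-3, -1, 3, 1] = replicate (length cube_adj) 6"
  by code_simp

text \<open>The witnesses are two opposite vertices, an inscribed tetrahedron, two opposite edges, and a face.\<close>

lemma cube_splits:
  "(\<exists>C. perfect_split cube_adj C b c) \<longleftrightarrow> (b, c) \<in> {(3, 1), (1, 3), (3, 3), (2, 2), (1, 1)}"
proof
  assume "\<exists>C. perfect_split cube_adj C b c"
  then obtain C where split: "perfect_split cube_adj C b c" by blast
  note constraints =
    perfect_split_constraints[OF cube_regular split cube_hoffman numeral_neq_zero]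
  have "b \<in> {1, 2, 3}" "c \<in> {1, 2, 3}"
    using constraints(2,3) by auto
  moreover have "card C * b = (8 - card C) * c"
    using constraints(1) unfolding cube_length .
  ultimately show "(b, c) \<in> {(3, 1), (1, 3), (3, 3), (2, 2), (1, 1)}"
    using constraints(4) by auto
next
  have c1: "perfect_split cube_adj (set [0, 7]) 3 1"
    by code_simp
  have c2: "perfect_split cube_adj (set [0, 3, 5, 6]) 3 3"
    by code_simp
  have c3: "perfect_split cube_adj (set [0, 1, 6, 7]) 2 2"
    by code_simp
  have c4: "perfect_split cube_adj (set [0, 1, 2, 3]) 1 1"
    by code_simp
  assume "(b, c) \<in> {(3, 1), (1, 3), (3, 3), (2, 2), (1, 1)}"
  then show "\<exists>C. perfect_split cube_adj C b c"
    using c1 c2 c3 c4 perfect_split_complement[OF cube_regular c1]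
    by auto
qed


subsection \<open>The octahedron\<close>

definition octahedron_vertices :: "gvec list" where
  "octahedron_vertices = [
    ((1, 0), (0, 0), (0, 0)), ((-1, 0), (0, 0), (0, 0)), ((0, 0), (1, 0), (0, 0)),
    ((0, 0), (-1, 0), (0, 0)), ((0, 0), (0, 0), (1, 0)), ((0, 0), (0, 0), (-1, 0))]"

definition octahedron_adj :: "nat list list" where
  "octahedron_adj = [
    [2, 3, 4, 5], [2, 3, 4, 5], [0, 1, 4, 5], [0, 1, 4, 5], [0, 1, 2, 3],
    [0, 1, 2, 3]]"

lemma octahedron_eq_hull: "octahedron = convex hull (vec3 ` set octahedron_vertices)"
  by (simp add: octahedron_def octahedron_vertices_def vec3_def)

lemma octahedron_represents:
  "represents (edge_graph octahedron) octahedron_adj (\<lambda>i. vec3 (octahedron_vertices ! i))"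
proof (rule represents_edge_graph[OF _ octahedron_eq_hull])
  show "edge_certificate octahedron_vertices octahedron_adj (1, 0) (0, 0) (4, 0) (1, 0) (2, 0)"
    by code_simp
qed

lemma octahedron_length: "length octahedron_adj = 6"
  by code_simp

lemma octahedron_regular: "regular_graph octahedron_adj 4"
  by code_simp

lemma octahedron_hoffman:
  "walk_poly octahedron_adj [0, 2, 1] = replicate (length octahedron_adj) 4"
  by code_simp

text \<open>The witnesses are a pair of opposite vertices and a face.
The case \<open>b = c = 3\<close> passes the eigenvalue test and the edge count. It fails because opposite
vertices have the same neighbours: they must then have the same colour, so that every vertex would
have an even number of neighbours of each colour.\<close>

lemma octahedron_splits:
  "(\<exists>C. perfect_split octahedron_adj C b c) \<longleftrightarrow> (b, c) \<in> {(4, 2), (2, 4), (2, 2)}"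
proof
  assume "\<exists>C. perfect_split octahedron_adj C b c"
  then obtain C where split: "perfect_split octahedron_adj C b c" by blast
  note constraints =
    perfect_split_constraints[OF octahedron_regular split octahedron_hoffman numeral_neq_zero]
  have "b \<in> {1, 2, 3, 4}" "c \<in> {1, 2, 3, 4}"
    using constraints(2,3) by auto
  moreover have "(b, c) \<noteq> (3, 3)"
  proof
    assume "(b, c) = (3, 3)"
    then have split33: "perfect_split octahedron_adj C 3 3" using split by simp
    have out: "card (set (octahedron_adj ! i) - C) = 3" if "i \<in> C" for i
      using split33 that by (simp add: perfect_split_def)
    have inn: "card (set (octahedron_adj ! i) \<inter> C) = 3" if "i < 6" "i \<notin> C" for i
      using split33 that by (simp add: perfect_split_def octahedron_length)
    \<comment> \<open>Vertices with the same four neighbours but different colours would have three neighbours of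
      either colour.\<close>
    have same: "j \<in> C"
      if "i \<in> C" "set (octahedron_adj ! i) = set (octahedron_adj ! j)" "i < 6" "j < 6" for i j
    proof (rule ccontr)
      assume "j \<notin> C"
      then have "card (set (octahedron_adj ! i) \<inter> C) = 3" using inn[of j] that by simp
      moreover have "card (set (octahedron_adj ! i)) = 4"
        using regular_graphD(3)[OF octahedron_regular, of i] that by (simp add: octahedron_length)
      ultimately show False
        using out[OF \<open>i \<in> C\<close>] card_Int_Diff[of "set (octahedron_adj ! i)" C] by simp
    qed
    have twins: "set (octahedron_adj ! 2) = set (octahedron_adj ! 3)"
      "set (octahedron_adj ! 4) = set (octahedron_adj ! 5)"
      by (simp_all add: octahedron_adj_def)
    have "2 \<in> C \<longleftrightarrow> 3 \<in> C" "4 \<in> C \<longleftrightarrow> 5 \<in> C"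
      using same[OF _ twins(1)] same[OF _ twins(1)[symmetric]]
        same[OF _ twins(2)] same[OF _ twins(2)[symmetric]] by auto
    moreover have "set (octahedron_adj ! 0) = {2, 3, 4, 5}" by (simp add: octahedron_adj_def)
    ultimately show False
      using out[of 0] inn[of 0]
      by (cases "0 \<in> C"; cases "2 \<in> C"; cases "4 \<in> C") (simp_all add: insert_Diff_if)
  qed
  ultimately have "(b, c) \<in> {(1, 3), (3, 1), (4, 2), (2, 4), (2, 2)}"
    using constraints(4) by (elim insertE emptyE) simp_all
  moreover have "card C * b = (6 - card C) * c"
    using constraints(1) unfolding octahedron_length .
  then have "(b, c) \<noteq> (1, 3)" "(b, c) \<noteq> (3, 1)" by auto presburger+
  ultimately show "(b, c) \<in> {(4, 2), (2, 4), (2, 2)}" by blast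
next
  have c1: "perfect_split octahedron_adj (set [0, 1]) 4 2"
    by code_simp
  have c2: "perfect_split octahedron_adj (set [0, 2, 4]) 2 2"
    by code_simp
  assume "(b, c) \<in> {(4, 2), (2, 4), (2, 2)}"
  then show "\<exists>C. perfect_split octahedron_adj C b c"
    using c1 c2 perfect_split_complement[OF octahedron_regular c1]
    by auto
qed


subsection \<open>The dodecahedron\<close>

definition dodecahedron_vertices :: "gvec list" where
  "dodecahedron_vertices = [
    ((1, 0), (1, 0), (1, 0)), ((1, 0), (1, 0), (-1, 0)), ((1, 0), (-1, 0), (1, 0)),
    ((1, 0), (-1, 0), (-1, 0)), ((-1, 0), (1, 0), (1, 0)), ((-1, 0), (1, 0), (-1, 0)),
    ((-1, 0), (-1, 0), (1, 0)), ((-1, 0), (-1, 0), (-1, 0)), ((0, 0), (-1, 1), (0, 1)),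
    ((0, 0), (-1, 1), (0, -1)), ((0, 0), (1, -1), (0, 1)), ((0, 0), (1, -1), (0, -1)),
    ((-1, 1), (0, 1), (0, 0)), ((-1, 1), (0, -1), (0, 0)), ((1, -1), (0, 1), (0, 0)),
    ((1, -1), (0, -1), (0, 0)), ((0, 1), (0, 0), (-1, 1)), ((0, -1), (0, 0), (-1, 1)),
    ((0, 1), (0, 0), (1, -1)), ((0, -1), (0, 0), (1, -1))]"

definition dodecahedron_adj :: "nat list list" where
  "dodecahedron_adj = [
    [8, 12, 16], [9, 12, 18], [10, 13, 16], [11, 13, 18], [8, 14, 17],
    [9, 14, 19], [10, 15, 17], [11, 15, 19], [0, 4, 10], [1, 5, 11],
    [2, 6, 8], [3, 7, 9], [0, 1, 14], [2, 3, 15], [4, 5, 12],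
    [6, 7, 13], [0, 2, 18], [4, 6, 19], [1, 3, 16], [5, 7, 17]]"

lemma dodecahedron_eq_hull: "dodecahedron = convex hull (vec3 ` set dodecahedron_vertices)"
  unfolding dodecahedron_def Collect_eq_UN_image2 Collect_eq_UN_image3
  by (simp add: dodecahedron_vertices_def vec3_def divide_golden_ratio insert_commute)

lemma dodecahedron_represents:
  "represents (edge_graph dodecahedron) dodecahedron_adj (\<lambda>i. vec3 (dodecahedron_vertices ! i))"
proof (rule represents_edge_graph[OF _ dodecahedron_eq_hull])
  show "edge_certificate dodecahedron_vertices dodecahedron_adj (3, 0) (-1, 2) (2, 0) (0, 1) (1, 0)"
    by code_simp
qed

lemma dodecahedron_length: "length dodecahedron_adj = 20"
  by code_simp

lemma dodecahedron_regular: "regular_graph dodecahedron_adj 3"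
  by code_simp

lemma dodecahedron_hoffman:
  "walk_poly dodecahedron_adj [0, 10, -5, -7, 1, 1] = replicate (length dodecahedron_adj) 6"
  by code_simp

text \<open>The first witness is an inscribed cube, the second a set of ten vertices that is invariant under
the antipodal map.\<close>

lemma dodecahedron_splits:
  "(\<exists>C. perfect_split dodecahedron_adj C b c) \<longleftrightarrow> (b, c) \<in> {(3, 2), (2, 3), (1, 1)}"
proof
  assume "\<exists>C. perfect_split dodecahedron_adj C b c"
  then obtain C where split: "perfect_split dodecahedron_adj C b c" by blast
  note constraints =
    perfect_split_constraints[OF dodecahedron_regular split dodecahedron_hoffman numeral_neq_zero]
  have "b \<in> {1, 2, 3}" "c \<in> {1, 2, 3}"
    using constraints(2,3) by auto
  moreover have "card C * b = (20 - card C) * c"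
    using constraints(1) unfolding dodecahedron_length .
  ultimately show "(b, c) \<in> {(3, 2), (2, 3), (1, 1)}"
    using constraints(4) by auto presburger+
next
  have c1: "perfect_split dodecahedron_adj (set [0, 1, 2, 3, 4, 5, 6, 7]) 3 2"
    by code_simp
  have c2: "perfect_split dodecahedron_adj (set [0, 1, 6, 7, 8, 9, 10, 11, 12, 15]) 1 1"
    by code_simp
  assume "(b, c) \<in> {(3, 2), (2, 3), (1, 1)}"
  then show "\<exists>C. perfect_split dodecahedron_adj C b c"
    using c1 c2 perfect_split_complement[OF dodecahedron_regular c1]
    by auto
qed


subsection \<open>The icosahedron\<close>

definition icosahedron_vertices :: "gvec list" where
  "icosahedron_vertices = [
    ((0, 0), (1, 0), (0, 1)), ((0, 0), (1, 0), (0, -1)), ((0, 0), (-1, 0), (0, 1)),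
    ((0, 0), (-1, 0), (0, -1)), ((1, 0), (0, 1), (0, 0)), ((1, 0), (0, -1), (0, 0)),
    ((-1, 0), (0, 1), (0, 0)), ((-1, 0), (0, -1), (0, 0)), ((0, 1), (0, 0), (1, 0)),
    ((0, -1), (0, 0), (1, 0)), ((0, 1), (0, 0), (-1, 0)), ((0, -1), (0, 0), (-1, 0))]"

definition icosahedron_adj :: "nat list list" where
  "icosahedron_adj = [
    [2, 4, 6, 8, 9], [3, 4, 6, 10, 11], [0, 5, 7, 8, 9], [1, 5, 7, 10, 11], [0, 1, 6, 8, 10],
    [2, 3, 7, 8, 10], [0, 1, 4, 9, 11], [2, 3, 5, 9, 11], [0, 2, 4, 5, 10], [0, 2, 6, 7, 11],
    [1, 3, 4, 5, 8], [1, 3, 6, 7, 9]]"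

lemma icosahedron_eq_hull: "icosahedron = convex hull (vec3 ` set icosahedron_vertices)"
  unfolding icosahedron_def Collect_eq_UN_image2 Collect_eq_UN_image3
  by (simp add: icosahedron_vertices_def vec3_def divide_golden_ratio insert_commute)

lemma icosahedron_represents:
  "represents (edge_graph icosahedron) icosahedron_adj (\<lambda>i. vec3 (icosahedron_vertices ! i))"
proof (rule represents_edge_graph[OF _ icosahedron_eq_hull])
  show "edge_certificate icosahedron_vertices icosahedron_adj (2, 1) (0, 1) (20, 10) (1, 3) (5, 0)"
    by code_simp
qed

lemma icosahedron_length: "length icosahedron_adj = 12"
  by code_simp

lemma icosahedron_regular: "regular_graph icosahedron_adj 5"
  by code_simp

lemma icosahedron_hoffman:
  "walk_poly icosahedron_adj [-5, -5, 1, 1] = replicate (length icosahedron_adj) 10"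
  by code_simp

text \<open>The witnesses are a pair of opposite vertices, an inscribed golden rectangle, and such a rectangle
together with a further pair of opposite vertices.\<close>

lemma icosahedron_splits:
  "(\<exists>C. perfect_split icosahedron_adj C b c) \<longleftrightarrow> (b, c) \<in> {(5, 1), (1, 5), (4, 2), (2, 4), (3, 3)}"
proof
  assume "\<exists>C. perfect_split icosahedron_adj C b c"
  then obtain C where split: "perfect_split icosahedron_adj C b c" by blast
  note constraints =
    perfect_split_constraints[OF icosahedron_regular split icosahedron_hoffman numeral_neq_zero]
  have "b \<in> {1, 2, 3, 4, 5}" "c \<in> {1, 2, 3, 4, 5}"
    using constraints(2,3) by auto
  moreover have "card C * b = (12 - card C) * c"
    using constraints(1) unfolding icosahedron_length .
  ultimately show "(b, c) \<in> {(5, 1), (1, 5), (4, 2), (2, 4), (3, 3)}"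
    using constraints(4) by auto
next
  have c1: "perfect_split icosahedron_adj (set [0, 3]) 5 1"
    by code_simp
  have c2: "perfect_split icosahedron_adj (set [0, 1, 2, 3]) 4 2"
    by code_simp
  have c3: "perfect_split icosahedron_adj (set [0, 1, 2, 3, 4, 7]) 3 3"
    by code_simp
  assume "(b, c) \<in> {(5, 1), (1, 5), (4, 2), (2, 4), (3, 3)}"
  then show "\<exists>C. perfect_split icosahedron_adj C b c"
    using c1 c2 c3 perfect_split_complement[OF icosahedron_regular c1] perfect_split_complement[OF icosahedron_regular c2]
    by auto
qed


theorem mainTheorem5:
  shows "(\<forall>A. perfect_2_coloring_matrix (edge_graph tetrahedron) A \<longleftrightarrow>
            (\<exists>B \<in> {mat2 0 3 1 2, mat2 1 2 2 1}. equivalent_matrices A B)) \<and>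
         (\<forall>A. perfect_2_coloring_matrix (edge_graph cube) A \<longleftrightarrow>
            (\<exists>B \<in> {mat2 0 3 1 2, mat2 0 3 3 0, mat2 1 2 2 1, mat2 2 1 1 2}.
               equivalent_matrices A B)) \<and>
         (\<forall>A. perfect_2_coloring_matrix (edge_graph octahedron) A \<longleftrightarrow>
            (\<exists>B \<in> {mat2 0 4 2 2, mat2 2 2 2 2}. equivalent_matrices A B)) \<and>
         (\<forall>A. perfect_2_coloring_matrix (edge_graph dodecahedron) A \<longleftrightarrow>
            (\<exists>B \<in> {mat2 0 3 2 1, mat2 2 1 1 2}. equivalent_matrices A B)) \<and>
         (\<forall>A. perfect_2_coloring_matrix (edge_graph icosahedron) A \<longleftrightarrow>
            (\<exists>B \<in> {mat2 0 5 1 4, mat2 1 4 2 3, mat2 2 3 3 2}. equivalent_matrices A B))"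
  unfolding
    mat2_of_splits[OF tetrahedron_represents tetrahedron_regular tetrahedron_splits]
    mat2_of_splits[OF cube_represents cube_regular cube_splits]
    mat2_of_splits[OF octahedron_represents octahedron_regular octahedron_splits]
    mat2_of_splits[OF dodecahedron_represents dodecahedron_regular dodecahedron_splits]
    mat2_of_splits[OF icosahedron_represents icosahedron_regular icosahedron_splits]
  by (auto simp: equivalent_mat2_iff)

end
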